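(* Consider the blocked collaborative bandits problem with $\mathsf M$ users, $\mathsf N$ items, $\mathsf C=1$ cluster (all rows of the reward matrix are identical), reward matrix $\mathbf P\in[0,1]^{\mathsf M\times\mathsf N}$, $\mathsf T$ rounds, blocking constraint $\mathsf B$, and noise variables i.i.d. Gaussian with mean $0$ and variance $1$, in the regime $\mathsf M,\mathsf N\gg\mathsf T$ (i.e. $\mathsf M,\mathsf N$ at least a sufficiently large constant multiple of $\mathsf T$). Then any algorithm must suffer, in the worst case over such reward matrices $\mathbf P$, a regret of at least $$\mathsf{Reg}(\mathsf T)=\Omega\left(\max\left(\sqrt{\frac{\mathsf N\mathsf B}{\mathsf M}},\ \frac{\mathsf T\sqrt{\log(\mathsf N/\mathsf T)}}{\mathsf B\sqrt{\mathsf M}}\right)\right),$$ where $\Omega$ hides a universal positive constant. That is, the infimum over algorithms (policies) of the supremum over $\mathbf P\in[0,1]^{\mathsf M\times\mathsf N}$ with all rows equal of $\mathsf{Reg}(\mathsf T)$ is bounded below by this quantity.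
   Context: Blocked collaborative bandits. There are $\mathsf M$ users, $\mathsf N$ items and $\mathsf T$ rounds, and an unknown reward matrix $\mathbf P\in\mathbb R^{\mathsf M\times\mathsf N}$. The users are partitioned into $\mathsf C$ disjoint unknown clusters, and users in the same cluster have identical rows of $\mathbf P$. In each round $t\in[\mathsf T]$, every user $u\in[\mathsf M]$ is recommended an item $\rho_u(t)\in[\mathsf N]$, chosen using the feedback of all users in previous rounds and possibly internal randomness. The system then observes $\mathbf R^{(t)}_{u\rho_u(t)}=\mathbf P_{u\rho_u(t)}+\mathbf E^{(t)}_{u\rho_u(t)}$, with $\mathbf E^{(t)}_{u\rho_u(t)}$ the noise. Blocking constraint: no item may be recommended to the same user more than $\mathsf B$ times. It is assumed that $\mathsf T$ is a multiple of $\mathsf B$ and $\mathsf N\ge\mathsf T/\mathsf B$. For each user $u$, $\pi_u:[\mathsf N]\to[\mathsf N]$ is a permutation with $\mathbf P_{u\pi_u(i)}\ge\mathbf P_{u\pi_u(j)}$ for $i<j$. The regret is $$\mathsf{Reg}(\mathsf T)=\sum_{s\in[\mathsf T/\mathsf B],\,u\in[\mathsf M]}\frac{\mathsf B\,\mathbf P_{u\pi_u(s)}}{\mathsf M}-\mathbb E\sum_{t\in[\mathsf T],\,u\in[\mathsf M]}\frac{\mathbf P_{u\rho_u(t)}}{\mathsf M},$$ with expectation over the randomness of the policy and the rewards.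
   Formalization: The lower bound is truncated at T, i.e. Reg(T) = Ω(min(T, max(...))): since rewards lie in [0,1], regret never exceeds T, while sqrt(NB/M) is unbounded as N grows with M, T, B fixed, so the untruncated claim fails (e.g. T = B = 1, M fixed, N large). *)

theory Defs
  imports "HOL-Probability.Probability" "HOL-Combinatorics.Permutations"
begin

text \<open>
  Users, items and rounds are numbered from 0: users \<open>u < M\<close>, items \<open>i < N\<close>, rounds \<open>t < T\<close>.
  A reward matrix is a function \<open>P :: nat \<Rightarrow> nat \<Rightarrow> real\<close>, of which only the entries \<open>P u i\<close> with
  \<open>u < M\<close> and \<open>i < N\<close> matter.

  A feedback history before round \<open>t\<close> gives the reward observed at each pair (round, user) in
  \<open>{..<t} \<times> {..<M}\<close> and is \<open>undefined\<close> elsewhere.  A policy maps its internal randomness \<open>w\<close>, the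
  current round, the feedback history and a user to the recommended item.  The items recommended
  in earlier rounds are functions of \<open>w\<close> and the earlier feedback, so they are not passed on.
  The internal randomness is a real sequence with an arbitrary law \<open>W\<close>, for instance one fresh
  uniform variable per round; as the item set is finite, this realises every randomised policy.
\<close>

type_synonym feedback = "nat \<times> nat \<Rightarrow> real"
type_synonym policy = "(nat \<Rightarrow> real) \<Rightarrow> nat \<Rightarrow> feedback \<Rightarrow> nat \<Rightarrow> nat"

definition feedback_space :: "nat \<Rightarrow> nat \<Rightarrow> feedback measure" where
  "feedback_space M t = (\<Pi>\<^sub>M _\<in>{..<t} \<times> {..<M}. borel)"

text \<open>The blocking constraint is imposed for every seed and every feedback sequence, so that it
  does not depend on the unknown reward matrix.\<close>

definition blocked_policy ::
  "nat \<Rightarrow> nat \<Rightarrow> nat \<Rightarrow> nat \<Rightarrow> (nat \<Rightarrow> real) measure \<Rightarrow> policy \<Rightarrow> bool" where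
  "blocked_policy M N T B W \<rho> \<longleftrightarrow>
     prob_space W \<and>
     (\<forall>t<T. \<forall>u<M. (\<lambda>(w, h). \<rho> w t h u) \<in> W \<Otimes>\<^sub>M feedback_space M t \<rightarrow>\<^sub>M count_space UNIV) \<and>
     (\<forall>w\<in>space W. \<forall>t<T. \<forall>h\<in>space (feedback_space M t). \<forall>u<M. \<rho> w t h u < N) \<and>
     (\<forall>w\<in>space W. \<forall>h\<in>space (feedback_space M T). \<forall>u<M. \<forall>i<N.
        card {t\<in>{..<T}. \<rho> w t (restrict h ({..<t} \<times> {..<M})) u = i} \<le> B)"

text \<open>The variable \<open>e (t, u)\<close> is the noise in the reward that user \<open>u\<close> produces in round \<open>t\<close>.\<close>

definition gaussian_noise :: "nat \<Rightarrow> nat \<Rightarrow> feedback measure" where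
  "gaussian_noise M T = (\<Pi>\<^sub>M _\<in>{..<T} \<times> {..<M}. density lborel (normal_density 0 1))"

primrec history ::
  "nat \<Rightarrow> (nat \<Rightarrow> nat \<Rightarrow> real) \<Rightarrow> policy \<Rightarrow> (nat \<Rightarrow> real) \<Rightarrow> feedback \<Rightarrow> nat \<Rightarrow> feedback" where
  "history M P \<rho> w e 0 = (\<lambda>_. undefined)"
| "history M P \<rho> w e (Suc t) =
     (\<lambda>(s, u). if s = t \<and> u < M then P u (\<rho> w t (history M P \<rho> w e t) u) + e (t, u)
               else history M P \<rho> w e t (s, u))"

definition recommended ::
  "nat \<Rightarrow> (nat \<Rightarrow> nat \<Rightarrow> real) \<Rightarrow> policy \<Rightarrow> (nat \<Rightarrow> real) \<Rightarrow> feedback \<Rightarrow> nat \<Rightarrow> nat \<Rightarrow> nat" where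
  "recommended M P \<rho> w e t u = \<rho> w t (history M P \<rho> w e t) u"

definition ranks_items :: "nat \<Rightarrow> (nat \<Rightarrow> real) \<Rightarrow> (nat \<Rightarrow> nat) \<Rightarrow> bool" where
  "ranks_items N r \<pi> \<longleftrightarrow>
     \<pi> permutes {..<N} \<and> (\<forall>i j. i < j \<longrightarrow> j < N \<longrightarrow> r (\<pi> i) \<ge> r (\<pi> j))"

text \<open>Such a ranking exists by \<open>ranks_items_item_ranking\<close> below, and the value of the regret does
  not depend on which one is chosen.\<close>

definition item_ranking :: "nat \<Rightarrow> (nat \<Rightarrow> real) \<Rightarrow> nat \<Rightarrow> nat" where
  "item_ranking N r = (SOME \<pi>. ranks_items N r \<pi>)"

definition regret ::
  "nat \<Rightarrow> nat \<Rightarrow> nat \<Rightarrow> nat \<Rightarrow> (nat \<Rightarrow> real) measure \<Rightarrow> policy \<Rightarrow> (nat \<Rightarrow> nat \<Rightarrow> real) \<Rightarrow> real" where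
  "regret M N T B W \<rho> P =
     (\<Sum>s<T div B. \<Sum>u<M. real B * P u (item_ranking N (P u) s) / real M) -
     (\<integral>(w, e). (\<Sum>t<T. \<Sum>u<M. P u (recommended M P \<rho> w e t u) / real M)
        \<partial>(W \<Otimes>\<^sub>M gaussian_noise M T))"

definition one_cluster_rewards :: "nat \<Rightarrow> nat \<Rightarrow> (nat \<Rightarrow> nat \<Rightarrow> real) set" where
  "one_cluster_rewards M N =
     {P. (\<forall>u<M. \<forall>i<N. 0 \<le> P u i \<and> P u i \<le> 1) \<and>
         (\<forall>u<M. \<forall>v<M. \<forall>i<N. P u i = P v i)}"

lemma ranks_items_item_ranking: "ranks_items N r (item_ranking N r)"
proof -
  define xs where "xs = sort_key (\<lambda>i. - r i) [0..<N]"
  define p where "p i = (if i < N then xs ! i else i)" for i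
  have len: "length xs = N" and set: "set xs = {..<N}" and dist: "distinct xs"
    by (auto simp: xs_def)
  have "bij_betw (\<lambda>i. xs ! i) {..<N} {..<N}"
    by (rule bij_betw_nth[OF dist]) (simp_all only: len set)
  then have "bij_betw p {..<N} {..<N}"
    by (rule bij_betw_cong[THEN iffD1, rotated]) (simp add: p_def)
  then have perm: "p permutes {..<N}"
    by (rule bij_imp_permutes) (simp add: p_def)
  have sorted: "sorted (map (\<lambda>i. - r i) xs)"
    by (simp add: xs_def)
  have "r (p i) \<ge> r (p j)" if "i < j" "j < N" for i j
    using sorted_nth_mono[OF sorted, of i j] that len by (simp add: p_def)
  with perm have "ranks_items N r p"
    by (simp add: ranks_items_def)
  then show ?thesis
    unfolding item_ranking_def by (rule someI[of "ranks_items N r"])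
qed

lemma history_in_feedback_space: "history M P \<rho> w e t \<in> space (feedback_space M t)"
  by (induction t) (auto simp: feedback_space_def space_PiM PiE_def extensional_def)

lemma restrict_history:
  "t \<le> t' \<Longrightarrow> restrict (history M P \<rho> w e t') ({..<t} \<times> {..<M}) = history M P \<rho> w e t"
proof (induction t' rule: dec_induct)
  case base
  show ?case
    using history_in_feedback_space[of M P \<rho> w e t]
    by (simp add: feedback_space_def space_PiM PiE_def extensional_restrict)
next
  case (step n)
  then show ?case
    by (auto simp: fun_eq_iff restrict_def split: if_splits)
qed

lemma recommended_less:
  assumes "blocked_policy M N T B W \<rho>" "w \<in> space W" "t < T" "u < M"
  shows "recommended M P \<rho> w e t u < N"
  using assms history_in_feedback_space[of M P \<rho> w e t]
  by (auto simp: blocked_policy_def recommended_def)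

lemma card_recommended_le:
  assumes "blocked_policy M N T B W \<rho>" "w \<in> space W" "u < M" "i < N"
  shows "card {t\<in>{..<T}. recommended M P \<rho> w e t u = i} \<le> B"
proof -
  have "{t\<in>{..<T}. recommended M P \<rho> w e t u = i} =
      {t\<in>{..<T}. \<rho> w t (restrict (history M P \<rho> w e T) ({..<t} \<times> {..<M})) u = i}"
    by (auto simp: recommended_def restrict_history)
  then show ?thesis
    using assms history_in_feedback_space[of M P \<rho> w e T] by (auto simp: blocked_policy_def)
qed

lemma measurable_history:
  assumes pol: "blocked_policy M N T B W \<rho>" and "t \<le> T"
  shows "(\<lambda>(w, e). history M P \<rho> w e t) \<in> W \<Otimes>\<^sub>M gaussian_noise M T \<rightarrow>\<^sub>M feedback_space M t"
  using \<open>t \<le> T\<close>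
proof (induction t)
  case 0
  show ?case by (simp add: feedback_space_def space_PiM)
next
  case (Suc t)
  let ?S = "W \<Otimes>\<^sub>M gaussian_noise M T"
  have IH: "(\<lambda>x. history M P \<rho> (fst x) (snd x) t) \<in> ?S \<rightarrow>\<^sub>M feedback_space M t"
    using Suc by (simp add: case_prod_beta')
  have item: "(\<lambda>x. \<rho> (fst x) t (history M P \<rho> (fst x) (snd x) t) u) \<in> ?S \<rightarrow>\<^sub>M count_space UNIV"
    if "u < M" for u
  proof -
    have "(\<lambda>(w, h). \<rho> w t h u) \<in> W \<Otimes>\<^sub>M feedback_space M t \<rightarrow>\<^sub>M count_space UNIV"
      using pol that Suc.prems by (auto simp: blocked_policy_def)
    from measurable_compose[OF measurable_Pair[OF measurable_fst IH] this]
    show ?thesis by (simp add: case_prod_beta')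
  qed
  have noise: "(\<lambda>x. snd x (t, u)) \<in> borel_measurable ?S" if "u < M" for u
  proof -
    have "(\<lambda>e. e (t, u)) \<in> gaussian_noise M T \<rightarrow>\<^sub>M density lborel (normal_density 0 1)"
      unfolding gaussian_noise_def using that Suc.prems by (intro measurable_component_singleton) auto
    then have "(\<lambda>e. e (t, u)) \<in> borel_measurable (gaussian_noise M T)" by simp
    from measurable_compose[OF measurable_snd this] show ?thesis .
  qed
  have "(\<lambda>x. history M P \<rho> (fst x) (snd x) (Suc t)) \<in> ?S \<rightarrow>\<^sub>M feedback_space M (Suc t)"
    unfolding feedback_space_def
  proof (rule measurable_PiM_single', goal_cases)
    case (1 su)
    obtain s u where su: "su = (s, u)" by force
    show ?case
    proof (cases "s = t")
      case True
      have "(\<lambda>x. P u (\<rho> (fst x) t (history M P \<rho> (fst x) (snd x) t) u)) \<in> borel_measurable ?S"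
        using 1 su by (intro measurable_compose[OF item]) auto
      then show ?thesis
        using True 1 su noise by auto
    next
      case False
      have "(\<lambda>x. history M P \<rho> (fst x) (snd x) t (s, u)) \<in> borel_measurable ?S"
        using 1 su False
        by (intro measurable_compose[OF IH[unfolded feedback_space_def]
              measurable_component_singleton]) auto
      then show ?thesis using False su by simp
    qed
  next
    case 2
    show ?case
      using history_in_feedback_space[of M P \<rho> _ _ "Suc t"]
      by (auto simp: feedback_space_def space_PiM simp del: history.simps)
  qed
  then show ?case by (simp add: case_prod_beta' del: history.simps)
qed

lemma measurable_recommended:
  assumes pol: "blocked_policy M N T B W \<rho>" and "t < T" "u < M"
  shows "(\<lambda>(w, e). recommended M P \<rho> w e t u)
           \<in> W \<Otimes>\<^sub>M gaussian_noise M T \<rightarrow>\<^sub>M count_space UNIV"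
proof -
  have h: "(\<lambda>x. history M P \<rho> (fst x) (snd x) t) \<in> W \<Otimes>\<^sub>M gaussian_noise M T \<rightarrow>\<^sub>M feedback_space M t"
    using measurable_history[OF pol, of t P] assms(2) by (simp add: case_prod_beta')
  have "(\<lambda>(w, h). \<rho> w t h u) \<in> W \<Otimes>\<^sub>M feedback_space M t \<rightarrow>\<^sub>M count_space UNIV"
    using assms by (auto simp: blocked_policy_def)
  from measurable_compose[OF measurable_Pair[OF measurable_fst h] this]
  show ?thesis by (simp add: case_prod_beta' recommended_def)
qed

text \<open>
  The following bound shows that the supremum of the regret over the reward matrices is a genuine
  one.  It also means that no lower bound can exceed \<open>T\<close>, while \<open>sqrt (N * B / M)\<close> is unbounded
  as \<open>N\<close> grows with \<open>M\<close>, \<open>T\<close> and \<open>B\<close> fixed; lower bounds of that order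
  must therefore be truncated at \<open>T\<close>.
\<close>

lemma regret_le_horizon:
  assumes pol: "blocked_policy M N T B W \<rho>" and P: "P \<in> one_cluster_rewards M N"
    and "M > 0" "T div B \<le> N"
  shows "regret M N T B W \<rho> P \<le> real T"
proof -
  have P01: "0 \<le> P u i" "P u i \<le> 1" if "u < M" "i < N" for u i
    using P that unfolding one_cluster_rewards_def by blast+
  have perm: "item_ranking N (P u) permutes {..<N}" for u
    using ranks_items_item_ranking by (simp add: ranks_items_def)
  have "(\<Sum>s<T div B. \<Sum>u<M. real B * P u (item_ranking N (P u) s) / real M)
      \<le> (\<Sum>s<T div B. \<Sum>u<M. real B * 1 / real M)"
  proof (intro sum_mono divide_right_mono mult_left_mono)
    fix s u assume "s \<in> {..<T div B}" "u \<in> {..<M}"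
    then have "item_ranking N (P u) s < N"
      using permutes_in_image[OF perm, of u s] \<open>T div B \<le> N\<close> by auto
    then show "P u (item_ranking N (P u) s) \<le> 1"
      using P01 \<open>u \<in> {..<M}\<close> by simp
  qed auto
  also have "\<dots> = real (T div B * B)" using \<open>M > 0\<close> by simp
  also have "\<dots> \<le> real T" by (simp only: of_nat_le_iff div_times_less_eq_dividend)
  finally have 1: "(\<Sum>s<T div B. \<Sum>u<M. real B * P u (item_ranking N (P u) s) / real M) \<le> real T" .
  have 2: "0 \<le> (\<integral>(w, e). (\<Sum>t<T. \<Sum>u<M. P u (recommended M P \<rho> w e t u) / real M)
        \<partial>(W \<Otimes>\<^sub>M gaussian_noise M T))"
    using P01 recommended_less[OF pol]
    by (intro Bochner_Integration.integral_nonneg)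
       (auto simp: space_pair_measure intro!: sum_nonneg divide_nonneg_nonneg)
  show ?thesis using 1 2 by (simp add: regret_def)
qed

end

theory Submission imports Defs begin

text \<open>
  Put \<open>k = T div B\<close>. The hard instances give reward \<open>\<epsilon>\<close> to the items of a \<open>k\<close>-element set \<open>S\<close>
  and reward \<open>0\<close> to all others. Then the regret is \<open>\<epsilon> * T\<close> minus \<open>\<epsilon> / M\<close> times the expected
  number of pulls of items of \<open>S\<close>. Adding an item \<open>i\<close> to a set \<open>R\<close> of size \<open>k - 1\<close> changes the law
  of the feedback by a likelihood ratio \<open>exp X\<close> with \<open>E X = - \<epsilon>\<^sup>2 / 2 * E n\<close>, where \<open>n\<close> is the number
  of pulls of \<open>i\<close>. As \<open>n \<le> M * B\<close> by blocking, \<open>n * exp X \<le> 2 * n + 2 * M * B * (exp X - 1 - X)\<close>, so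
  the expected number of pulls of \<open>i\<close> grows at most by the factor \<open>2 + \<epsilon>\<^sup>2 * M * B\<close>. Averaging over
  all \<open>R\<close> and \<open>i\<close> yields a set \<open>S\<close> whose items receive at most half of the \<open>M * T\<close> pulls, as long
  as \<open>\<epsilon>\<^sup>2 \<le> N / (8 * M * T)\<close>. The resulting bound of order \<open>min T (sqrt (N * T / M))\<close> dominates
  both terms of the claim, the second one because \<open>ln x \<le> x\<close>.
\<close>

section \<open>Translating Gaussian noise: change of measure on finite products\<close>

abbreviation std_normal :: "real measure" where
  "std_normal \<equiv> density lborel std_normal_density"

lemma prob_space_std_normal: "prob_space std_normal"
  by (rule prob_space_normal_density) simp

interpretation std_normal: product_sigma_finite "\<lambda>_. std_normal"
  by (intro product_sigma_finite.intro prob_space_imp_sigma_finite prob_space_std_normal)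

lemma prob_space_PiM_std_normal: "prob_space (PiM I (\<lambda>_. std_normal))"
  by (intro prob_space_PiM prob_space_std_normal)

lemma measurable_component_std_normal:
  "i \<in> I \<Longrightarrow> (\<lambda>e. e i) \<in> borel_measurable (PiM I (\<lambda>_. std_normal))"
  using measurable_component_singleton[of i I "\<lambda>_. std_normal"] by simp

lemma measurable_fun_upd_std_normal:
  assumes "i \<in> I" "g \<in> borel_measurable (PiM I (\<lambda>_. std_normal))"
  shows "(\<lambda>e. e(i := g e)) \<in> PiM I (\<lambda>_. std_normal) \<rightarrow>\<^sub>M PiM I (\<lambda>_. std_normal)"
proof (rule measurable_PiM_single')
  show "(\<lambda>e. (e(i := g e)) j) \<in> PiM I (\<lambda>_. std_normal) \<rightarrow>\<^sub>M std_normal" if "j \<in> I" for j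
    using assms measurable_component_std_normal[OF that] by (cases "j = i") auto
  show "(\<lambda>e. e(i := g e)) \<in> space (PiM I (\<lambda>_. std_normal)) \<rightarrow> (\<Pi>\<^sub>E j\<in>I. space std_normal)"
    using assms(1) by (auto simp: space_PiM PiE_def extensional_def)
qed

text \<open>Completing the square: the exponential weight is the ratio of the normal density centred
  at \<open>a\<close> to the one centred at 0, and Lebesgue measure is translation
  invariant.\<close>

lemma nn_integral_std_normal_shift:
  fixes g :: "real \<Rightarrow> ennreal"
  assumes [measurable]: "g \<in> borel_measurable borel"
  shows "(\<integral>\<^sup>+y. g (y + a) \<partial>std_normal) = (\<integral>\<^sup>+y. g y * ennreal (exp (a * y - a\<^sup>2 / 2)) \<partial>std_normal)"
proof -
  have "(\<integral>\<^sup>+y. g y * ennreal (exp (a * y - a\<^sup>2 / 2)) \<partial>std_normal)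
      = (\<integral>\<^sup>+y. ennreal (std_normal_density y) * (g y * ennreal (exp (a * y - a\<^sup>2 / 2))) \<partial>lborel)"
    by (subst nn_integral_density) auto
  also have "\<dots> = (\<integral>\<^sup>+y. ennreal (std_normal_density (y - a)) * g y \<partial>lborel)"
  proof (intro nn_integral_cong)
    fix y :: real
    have "exp (- y\<^sup>2 / 2) * exp (a * y - a\<^sup>2 / 2) = exp (- (y - a)\<^sup>2 / 2)"
      by (subst exp_add[symmetric]) (simp add: power2_eq_square field_simps)
    then have "std_normal_density y * exp (a * y - a\<^sup>2 / 2) = std_normal_density (y - a)"
      by (simp add: std_normal_density_def)
    then show "ennreal (std_normal_density y) * (g y * ennreal (exp (a * y - a\<^sup>2 / 2)))
        = ennreal (std_normal_density (y - a)) * g y"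
      by (simp add: ennreal_mult' mult_ac flip: ennreal_mult)
  qed
  also have "\<dots> = (\<integral>\<^sup>+y. ennreal (std_normal_density y) * g (y + a) \<partial>lborel)"
    by (subst nn_integral_real_affine[where c = 1 and t = a]) (auto simp: add.commute)
  also have "\<dots> = (\<integral>\<^sup>+y. g (y + a) \<partial>std_normal)"
    by (subst nn_integral_density) auto
  finally show ?thesis ..
qed

text \<open>By Tonelli, coordinate \<open>i\<close> can be integrated innermost. On each slice the
  shift is a constant, because \<open>d\<close> may depend on the other coordinates but not on
  \<open>i\<close>, so the one-dimensional formula applies.\<close>

lemma nn_integral_PiM_std_normal_shift_coordinate:
  fixes F :: "('i \<Rightarrow> real) \<Rightarrow> ennreal"
  assumes I: "finite I" "i \<in> I"
    and d: "d \<in> borel_measurable (PiM I (\<lambda>_. std_normal))" "\<And>e y. d (e(i := y)) = d e"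
    and F: "F \<in> borel_measurable (PiM I (\<lambda>_. std_normal))"
  shows "(\<integral>\<^sup>+e. F (e(i := e i + d e)) \<partial>PiM I (\<lambda>_. std_normal))
       = (\<integral>\<^sup>+e. F e * ennreal (exp (d e * e i - (d e)\<^sup>2 / 2)) \<partial>PiM I (\<lambda>_. std_normal))"
proof -
  define J where "J = I - {i}"
  have J: "finite J" "i \<notin> J" and I_eq: "I = insert i J"
    using I by (auto simp: J_def)
  note [measurable] = d(1) F measurable_component_std_normal[OF I(2)]
  have "(\<lambda>e. e(i := e i + d e)) \<in> PiM I (\<lambda>_. std_normal) \<rightarrow>\<^sub>M PiM I (\<lambda>_. std_normal)"
    using I(2) by (intro measurable_fun_upd_std_normal) measurable
  from measurable_compose[OF this F]
  have "(\<integral>\<^sup>+e. F (e(i := e i + d e)) \<partial>PiM I (\<lambda>_. std_normal))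
      = (\<integral>\<^sup>+x. \<integral>\<^sup>+y. F (x(i := y + d x)) \<partial>std_normal \<partial>PiM J (\<lambda>_. std_normal))"
    unfolding I_eq by (subst std_normal.product_nn_integral_insert[OF J]) (simp_all add: d(2))
  also have "\<dots> = (\<integral>\<^sup>+x. \<integral>\<^sup>+y. F (x(i := y)) * ennreal (exp (d x * y - (d x)\<^sup>2 / 2))
      \<partial>std_normal \<partial>PiM J (\<lambda>_. std_normal))"
  proof (rule nn_integral_cong)
    fix x assume x: "x \<in> space (PiM J (\<lambda>_. std_normal))"
    have "(\<lambda>y. x(i := y)) \<in> std_normal \<rightarrow>\<^sub>M PiM I (\<lambda>_. std_normal)"
      unfolding I_eq using x by (rule measurable_component_update) fact
    from measurable_compose[OF this F]
    have "(\<lambda>y. F (x(i := y))) \<in> borel_measurable borel" by simp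
    from nn_integral_std_normal_shift[OF this]
    show "(\<integral>\<^sup>+y. F (x(i := y + d x)) \<partial>std_normal)
        = (\<integral>\<^sup>+y. F (x(i := y)) * ennreal (exp (d x * y - (d x)\<^sup>2 / 2)) \<partial>std_normal)" .
  qed
  also have "\<dots> = (\<integral>\<^sup>+e. F e * ennreal (exp (d e * e i - (d e)\<^sup>2 / 2)) \<partial>PiM I (\<lambda>_. std_normal))"
  proof -
    have "(\<lambda>e. F e * ennreal (exp (d e * e i - (d e)\<^sup>2 / 2))) \<in> borel_measurable (PiM I (\<lambda>_. std_normal))"
      by measurable
    then show ?thesis
      unfolding I_eq by (subst std_normal.product_nn_integral_insert[OF J]) (simp_all add: d(2))
  qed
  finally show ?thesis .
qed

text \<open>All amounts \<open>d i\<close> are evaluated at the unshifted \<open>e\<close>, so this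
  is a simultaneous shift and not a sequence of updates.\<close>

definition shift_coords :: "'i set \<Rightarrow> ('i \<Rightarrow> ('i \<Rightarrow> real) \<Rightarrow> real) \<Rightarrow> ('i \<Rightarrow> real) \<Rightarrow> 'i \<Rightarrow> real" where
  "shift_coords J d e = (\<lambda>i. if i \<in> J then e i + d i e else e i)"

lemma measurable_shift_coords:
  assumes "J \<subseteq> I" "\<And>i. i \<in> J \<Longrightarrow> d i \<in> borel_measurable (PiM I (\<lambda>_. std_normal))"
  shows "shift_coords J d \<in> PiM I (\<lambda>_. std_normal) \<rightarrow>\<^sub>M PiM I (\<lambda>_. std_normal)"
proof (rule measurable_PiM_single')
  show "(\<lambda>e. shift_coords J d e i) \<in> PiM I (\<lambda>_. std_normal) \<rightarrow>\<^sub>M std_normal" if "i \<in> I" for i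
  proof -
    note [measurable] = measurable_component_std_normal[OF that]
    show ?thesis
      using assms(2)[of i] by (cases "i \<in> J") (simp_all add: shift_coords_def)
  qed
  show "shift_coords J d \<in> space (PiM I (\<lambda>_. std_normal)) \<rightarrow> (\<Pi>\<^sub>E j\<in>I. space std_normal)"
    using assms(1) by (auto simp: shift_coords_def space_PiM PiE_def extensional_def)
qed

text \<open>Since no \<open>d i\<close> with \<open>i\<close> in \<open>J\<close> reacts to a
  coordinate in \<open>J\<close>, the simultaneous shift is a composition of one-coordinate shifts,
  and the weights multiply. This is the situation within one round, where the shifts for all users
  depend on earlier rounds only.\<close>

lemma nn_integral_PiM_std_normal_shift_coords:
  fixes F :: "('i \<Rightarrow> real) \<Rightarrow> ennreal"
  assumes I: "finite I" "J \<subseteq> I"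
    and d: "\<And>i. i \<in> J \<Longrightarrow> d i \<in> borel_measurable (PiM I (\<lambda>_. std_normal))"
      "\<And>i j e y. i \<in> J \<Longrightarrow> j \<in> J \<Longrightarrow> d i (e(j := y)) = d i e"
    and F: "F \<in> borel_measurable (PiM I (\<lambda>_. std_normal))"
  shows "(\<integral>\<^sup>+e. F (shift_coords J d e) \<partial>PiM I (\<lambda>_. std_normal))
       = (\<integral>\<^sup>+e. F e * (\<Prod>i\<in>J. ennreal (exp (d i e * e i - (d i e)\<^sup>2 / 2))) \<partial>PiM I (\<lambda>_. std_normal))"
proof -
  have "finite J" using I finite_subset by blast
  then show ?thesis using I(2) d F
  proof (induction J arbitrary: F)
    case empty
    then show ?case by (simp add: shift_coords_def)
  next
    case (insert j J)
    let ?M = "PiM I (\<lambda>_. std_normal)"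
    define l where "l e = ennreal (exp (d j e * e j - (d j e)\<^sup>2 / 2))" for e
    have j: "j \<in> I" and J: "J \<subseteq> I" using insert.prems(1) by auto
    have [measurable]: "d j \<in> borel_measurable ?M" by (rule insert.prems(2)) simp
    note [measurable] = measurable_component_std_normal[OF j] \<open>F \<in> borel_measurable ?M\<close>
    have [measurable]: "shift_coords J d \<in> ?M \<rightarrow>\<^sub>M ?M"
      using J insert.prems(2) by (intro measurable_shift_coords) auto
    have l_meas: "l \<in> borel_measurable ?M" unfolding l_def by measurable
    \<comment> \<open>Coordinate \<open>j\<close> is shifted first; this changes none of the amounts
      used for the others.\<close>
    have split: "shift_coords (insert j J) d e = shift_coords J d (e(j := e j + d j e))" for e
    proof -
      have "d i (e(j := e j + d j e)) = d i e" if "i \<in> insert j J" for i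
        using insert.prems(3) that by blast
      then show ?thesis
        using insert.hyps by (auto simp: shift_coords_def fun_eq_iff)
    qed
    note d_upd = insert.prems(3)
    \<comment> \<open>The hypothesis covers one update at a time, whereas a shift along
      \<open>J\<close> overwrites many coordinates at once; induction over the overwritten set
      bridges this.\<close>
    have d_inv: "d j (\<lambda>i. if i \<in> J' then g i else e i) = d j e" if "finite J'" "J' \<subseteq> J" for J' g e
      using that
    proof (induction J' rule: finite_induct)
      case empty
      then show ?case by simp
    next
      case (insert k K)
      have "(\<lambda>i. if i \<in> insert k K then g i else e i) = (\<lambda>i. if i \<in> K then g i else e i)(k := g k)"
        by (auto simp: fun_eq_iff)
      moreover have "d j (\<lambda>i. if i \<in> K then g i else e i) = d j e"
        using insert.IH insert.prems by simp
      ultimately show ?case using d_upd[of j k] insert.prems by (simp del: fun_upd_apply)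
    qed
    have l_inv: "l (shift_coords J d e) = l e" for e
      using d_inv[of J "\<lambda>i. e i + d i e" e] insert.hyps by (simp add: l_def shift_coords_def)
    have "(\<integral>\<^sup>+e. F (shift_coords (insert j J) d e) \<partial>?M)
        = (\<integral>\<^sup>+e. F (shift_coords J d e) * l e \<partial>?M)"
      unfolding split l_def
    proof (rule nn_integral_PiM_std_normal_shift_coordinate[OF I(1) j])
      show "d j (e(j := y)) = d j e" for e y by (rule d_upd) simp_all
    qed measurable
    \<comment> \<open>With the weight of \<open>j\<close> also read at the shifted point, the
      integrand is \<open>F * l\<close> composed with the shift, which fits the induction hypothesis
      for arbitrary integrands.\<close>
    also have "\<dots> = (\<integral>\<^sup>+e. F (shift_coords J d e) * l (shift_coords J d e) \<partial>?M)"
      by (simp add: l_inv)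
    also have "\<dots> = (\<integral>\<^sup>+e. (F e * l e) * (\<Prod>i\<in>J. ennreal (exp (d i e * e i - (d i e)\<^sup>2 / 2))) \<partial>?M)"
      using l_meas insert.prems by (intro insert.IH[where F = "\<lambda>e. F e * l e"]) auto
    finally show ?case
      using insert.hyps by (simp add: l_def mult.assoc)
  qed
qed

text \<open>\<open>d\<close> ignores coordinate \<open>i\<close>, so integrating that centred
  coordinate first gives zero; the bound \<open>b\<close> supplies integrability. This removes the
  linear part of the log-likelihood ratio later on.\<close>

lemma
  fixes d :: "('i \<Rightarrow> real) \<Rightarrow> real"
  assumes I: "finite I" "i \<in> I"
    and d: "d \<in> borel_measurable (PiM I (\<lambda>_. std_normal))" "\<And>e y. d (e(i := y)) = d e"
      "\<And>e. \<bar>d e\<bar> \<le> b"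
  shows integrable_mult_std_normal_coordinate:
      "integrable (PiM I (\<lambda>_. std_normal)) (\<lambda>e. d e * e i)"
    and integral_mult_std_normal_coordinate:
      "(\<integral>e. d e * e i \<partial>PiM I (\<lambda>_. std_normal)) = 0"
proof -
  define J where "J = I - {i}"
  have J: "finite J" "i \<notin> J" and I_eq: "I = insert i J"
    using I by (auto simp: J_def)
  note [measurable] = d(1) measurable_component_std_normal[OF I(2)]
  have int_id: "integrable std_normal (\<lambda>x. x)"
    using integrable_std_normal_moment[of 1] by (subst integrable_density) auto
  have "distr (PiM I (\<lambda>_. std_normal)) std_normal (\<lambda>e. e i) = std_normal"
    by (rule distr_PiM_component) (auto intro: prob_space_std_normal I)
  with int_id have "integrable (distr (PiM I (\<lambda>_. std_normal)) std_normal (\<lambda>e. e i)) (\<lambda>x. x)"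
    by simp
  then have "integrable (PiM I (\<lambda>_. std_normal)) (\<lambda>e. e i)"
    by (subst (asm) integrable_distr_eq) auto
  then show int: "integrable (PiM I (\<lambda>_. std_normal)) (\<lambda>e. d e * e i)"
    by (rule Bochner_Integration.integrable_bound[OF integrable_mult_right[where c = b]])
       (use d(3) order_trans[OF abs_ge_zero d(3)] in \<open>auto simp: abs_mult intro!: mult_mono\<close>)
  have 0: "(\<integral>y. y \<partial>std_normal) = 0"
    using integral_std_normal_moment_odd[of 0] by (subst integral_density) auto
  have "(\<integral>e. d e * e i \<partial>PiM I (\<lambda>_. std_normal))
      = (\<integral>x. \<integral>y. d x * y \<partial>std_normal \<partial>PiM J (\<lambda>_. std_normal))"
    using int unfolding I_eq by (subst std_normal.product_integral_insert[OF J]) (auto simp: d(2))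
  also have "\<dots> = 0" by (simp add: 0)
  finally show "(\<integral>e. d e * e i \<partial>PiM I (\<lambda>_. std_normal)) = 0" .
qed


section \<open>Coupling the runs under two reward matrices, and their likelihood ratio\<close>

lemma history_cong:
  assumes "\<And>s u. s < t \<Longrightarrow> u < M \<Longrightarrow> e (s, u) = e' (s, u)"
  shows "history M P \<rho> w e t = history M P \<rho> w e' t"
  using assms
proof (induction t)
  case (Suc t)
  then have "history M P \<rho> w e t = history M P \<rho> w e' t" by simp
  then show ?case using Suc.prems by (auto intro!: ext)
qed simp

lemma recommended_cong:
  assumes "\<And>s v. s < t \<Longrightarrow> v < M \<Longrightarrow> e (s, v) = e' (s, v)"
  shows "recommended M P \<rho> w e t u = recommended M P \<rho> w e' t u"
  using history_cong[of t M e e' P \<rho> w] assms by (simp add: recommended_def)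

text \<open>\<open>R\<close> generates the run, and \<open>P\<close> and \<open>Q\<close> are
  compared at the items it recommends. The cell \<open>c\<close> precedes the noise so that a
  partial application fits the argument \<open>d\<close> of \<open>shift_coords\<close>.\<close>

definition reward_gap ::
  "nat \<Rightarrow> (nat \<Rightarrow> nat \<Rightarrow> real) \<Rightarrow> (nat \<Rightarrow> nat \<Rightarrow> real) \<Rightarrow> (nat \<Rightarrow> nat \<Rightarrow> real) \<Rightarrow>
     policy \<Rightarrow> (nat \<Rightarrow> real) \<Rightarrow> nat \<times> nat \<Rightarrow> feedback \<Rightarrow> real" where
  "reward_gap M P Q R \<rho> w c e = (case c of (s, u) \<Rightarrow>
     P u (recommended M R \<rho> w e s u) - Q u (recommended M R \<rho> w e s u))"

text \<open>The noise absorbs the difference of rewards: in the first \<open>t\<close> rounds, at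
  the items recommended under \<open>P\<close>, \<open>Q\<close> plus the shifted noise equals
  \<open>P\<close> plus the original noise.\<close>

definition shift_noise ::
  "nat \<Rightarrow> (nat \<Rightarrow> nat \<Rightarrow> real) \<Rightarrow> (nat \<Rightarrow> nat \<Rightarrow> real) \<Rightarrow> policy \<Rightarrow> (nat \<Rightarrow> real) \<Rightarrow>
     nat \<Rightarrow> feedback \<Rightarrow> feedback" where
  "shift_noise M P Q \<rho> w t = shift_coords ({..<t} \<times> {..<M}) (reward_gap M P Q P \<rho> w)"

text \<open>With the noise shifted by the reward gap, the policy cannot tell \<open>Q\<close> from \<open>P\<close>.\<close>

lemma history_shift_noise:
  "s \<le> t \<Longrightarrow> history M Q \<rho> w (shift_noise M P Q \<rho> w t e) s = history M P \<rho> w e s"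
proof (induction s)
  case (Suc s)
  then have "history M Q \<rho> w (shift_noise M P Q \<rho> w t e) s = history M P \<rho> w e s" by simp
  moreover have "shift_noise M P Q \<rho> w t e (s, u) =
      e (s, u) + (P u (\<rho> w s (history M P \<rho> w e s) u) - Q u (\<rho> w s (history M P \<rho> w e s) u))"
    if "u < M" for u
    using that Suc.prems
    by (simp add: shift_noise_def shift_coords_def reward_gap_def recommended_def)
  ultimately show ?case by (auto intro!: ext)
qed simp

lemma recommended_shift_noise:
  "s \<le> t \<Longrightarrow> recommended M Q \<rho> w (shift_noise M P Q \<rho> w t e) s u = recommended M P \<rho> w e s u"
  by (simp add: recommended_def history_shift_noise)

text \<open>The definition evaluates gaps along the run under \<open>P\<close>, whereas the
  likelihood ratio needs them along the run under \<open>Q\<close>. Once the earlier noise is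
  shifted, both runs recommend the same items in round \<open>t\<close>, which permits the exchange
  and an induction over rounds.\<close>

lemma shift_noise_Suc:
  "shift_noise M P Q \<rho> w (Suc t) e =
     shift_coords ({t} \<times> {..<M}) (reward_gap M P Q Q \<rho> w) (shift_noise M P Q \<rho> w t e)"
proof (rule ext)
  fix c
  show "shift_noise M P Q \<rho> w (Suc t) e c =
     shift_coords ({t} \<times> {..<M}) (reward_gap M P Q Q \<rho> w) (shift_noise M P Q \<rho> w t e) c"
  proof (cases "fst c = t")
    case True
    then have "shift_noise M P Q \<rho> w t e c = e c"
      by (auto simp: shift_noise_def shift_coords_def)
    then show ?thesis using True
      by (cases c) (auto simp: shift_noise_def[of _ _ _ _ _ "Suc t"] shift_coords_def[of "_ \<times> _"]
            reward_gap_def recommended_shift_noise)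
  next
    case False
    then show ?thesis
      by (cases c) (auto simp: shift_noise_def shift_coords_def)
  qed
qed

lemma measurable_recommended_seed:
  assumes "blocked_policy M N T B W \<rho>" "w \<in> space W" "t < T" "u < M"
  shows "(\<lambda>e. recommended M P \<rho> w e t u) \<in> gaussian_noise M T \<rightarrow>\<^sub>M count_space UNIV"
  using measurable_compose[OF measurable_Pair1' measurable_recommended[OF assms(1,3,4)]] assms(2)
  by simp

lemma measurable_reward_gap:
  assumes "blocked_policy M N T B W \<rho>" "w \<in> space W" "c \<in> {..<T} \<times> {..<M}"
  shows "reward_gap M P Q R \<rho> w c \<in> borel_measurable (gaussian_noise M T)"
proof -
  obtain s u where c: "c = (s, u)" "s < T" "u < M" using assms(3) by auto
  have "(\<lambda>i. P u i - Q u i) \<in> borel_measurable (count_space UNIV)" by simp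
  from measurable_compose[OF measurable_recommended_seed[OF assms(1,2) c(2,3)] this]
  show ?thesis by (simp add: c(1) reward_gap_def[abs_def])
qed

text \<open>Predictability: the items of a round are chosen before its noise appears. Hence the gap
  at \<open>c\<close> ignores all noise of its own round, as the Gaussian shift lemmas
  require.\<close>

lemma reward_gap_cong:
  assumes "\<And>s u. s < fst c \<Longrightarrow> u < M \<Longrightarrow> e (s, u) = e' (s, u)"
  shows "reward_gap M P Q R \<rho> w c e = reward_gap M P Q R \<rho> w c e'"
proof -
  have "recommended M R \<rho> w e (fst c) u = recommended M R \<rho> w e' (fst c) u" for u
    using assms by (rule recommended_cong)
  then show ?thesis by (simp add: reward_gap_def case_prod_beta)
qed

text \<open>
  A discrete Girsanov formula: the product on the right is the likelihood ratio of the feedback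
  in the first \<open>t\<close> rounds under \<open>P\<close> and under \<open>Q\<close>.
\<close>

lemma nn_integral_shift_noise:
  fixes F :: "feedback \<Rightarrow> ennreal"
  assumes pol: "blocked_policy M N T B W \<rho>" and w: "w \<in> space W" and "t \<le> T"
    and "F \<in> borel_measurable (gaussian_noise M T)"
  shows "(\<integral>\<^sup>+e. F (shift_noise M P Q \<rho> w t e) \<partial>gaussian_noise M T) =
     (\<integral>\<^sup>+e. F e * (\<Prod>c\<in>{..<t} \<times> {..<M}.
        ennreal (exp (reward_gap M P Q Q \<rho> w c e * e c - (reward_gap M P Q Q \<rho> w c e)\<^sup>2 / 2)))
      \<partial>gaussian_noise M T)"
  using assms(3,4)
proof (induction t arbitrary: F)
  case 0
  then show ?case by (simp add: shift_noise_def shift_coords_def)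
next
  case (Suc t)
  define l where "l c e = ennreal (exp (reward_gap M P Q Q \<rho> w c e * e c
      - (reward_gap M P Q Q \<rho> w c e)\<^sup>2 / 2))" for c :: "nat \<times> nat" and e :: feedback
  define L where "L e = (\<Prod>c\<in>{..<t} \<times> {..<M}. l c e)" for e
  let ?G = "gaussian_noise M T"
  let ?row = "shift_coords ({t} \<times> {..<M}) (reward_gap M P Q Q \<rho> w)"
  have gap_meas: "reward_gap M P Q Q \<rho> w c \<in> borel_measurable ?G" if "c \<in> {..<T} \<times> {..<M}" for c
    using measurable_reward_gap[OF pol w that] .
  \<comment> \<open>\<open>std_normal_density\<close> abbreviates \<open>normal_density 0 1\<close>,
    so \<open>gaussian_noise\<close> unfolds to the product of \<open>std_normal\<close> treated
    above.\<close>
  have row_meas: "?row \<in> ?G \<rightarrow>\<^sub>M ?G"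
    using Suc.prems gap_meas unfolding gaussian_noise_def by (intro measurable_shift_coords) auto
  have l_meas: "l c \<in> borel_measurable ?G" if "c \<in> {..<T} \<times> {..<M}" for c
  proof -
    have [measurable]: "(\<lambda>e. e c) \<in> borel_measurable ?G"
      unfolding gaussian_noise_def using that by (rule measurable_component_std_normal)
    note [measurable] = gap_meas[OF that]
    show ?thesis unfolding l_def by measurable
  qed
  have L_meas: "L \<in> borel_measurable ?G"
    unfolding L_def[abs_def] using Suc.prems by (intro borel_measurable_prod_ennreal l_meas) auto
  \<comment> \<open>\<open>L\<close> looks only at noise before round \<open>t\<close>, and
    \<open>?row\<close> changes only round \<open>t\<close>.\<close>
  have L_row: "L (?row e) = L e" for e
  proof -
    have "l c (?row e) = l c e" if "c \<in> {..<t} \<times> {..<M}" for c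
    proof -
      have "reward_gap M P Q Q \<rho> w c (?row e) = reward_gap M P Q Q \<rho> w c e"
        using that by (intro reward_gap_cong) (auto simp: shift_coords_def)
      moreover have "?row e c = e c" using that by (auto simp: shift_coords_def)
      ultimately show ?thesis by (simp add: l_def)
    qed
    then show ?thesis unfolding L_def by (rule prod.cong[OF refl])
  qed
  have "(\<integral>\<^sup>+e. F (shift_noise M P Q \<rho> w (Suc t) e) \<partial>?G) = (\<integral>\<^sup>+e. F (?row e) * L e \<partial>?G)"
    unfolding shift_noise_Suc L_def l_def
    using Suc.prems measurable_compose[OF row_meas Suc.prems(2)]
    by (intro Suc.IH[where F = "\<lambda>e. F (?row e)"]) auto
  also have "\<dots> = (\<integral>\<^sup>+e. F (?row e) * L (?row e) \<partial>?G)"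
    by (simp only: L_row)
  \<comment> \<open>The induction hypothesis has removed the shifts before round \<open>t\<close>;
    the multi-coordinate formula now removes round \<open>t\<close>, whose gaps ignore the noise of
    that round.\<close>
  also have "\<dots> = (\<integral>\<^sup>+e. (F e * L e) * (\<Prod>c\<in>{t} \<times> {..<M}. l c e) \<partial>?G)"
    unfolding gaussian_noise_def l_def
  proof (rule nn_integral_PiM_std_normal_shift_coords[where F = "\<lambda>e. F e * L e"])
    show "{t} \<times> {..<M} \<subseteq> {..<T} \<times> {..<M}" using Suc.prems by auto
    show "reward_gap M P Q Q \<rho> w c \<in> borel_measurable (PiM ({..<T} \<times> {..<M}) (\<lambda>_. std_normal))"
      if "c \<in> {t} \<times> {..<M}" for c
      using that Suc.prems gap_meas[of c] unfolding gaussian_noise_def by auto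
    show "reward_gap M P Q Q \<rho> w c (e(c' := y)) = reward_gap M P Q Q \<rho> w c e"
      if "c \<in> {t} \<times> {..<M}" "c' \<in> {t} \<times> {..<M}" for c c' e y
      using that by (intro reward_gap_cong) auto
    show "(\<lambda>e. F e * L e) \<in> borel_measurable (PiM ({..<T} \<times> {..<M}) (\<lambda>_. std_normal))"
      using Suc.prems(2) L_meas unfolding gaussian_noise_def by measurable
  qed simp
  also have "\<dots> = (\<integral>\<^sup>+e. F e * (\<Prod>c\<in>{..<Suc t} \<times> {..<M}. l c e) \<partial>?G)"
  proof (rule nn_integral_cong)
    fix e
    have "{..<Suc t} \<times> {..<M} = {..<t} \<times> {..<M} \<union> {t} \<times> {..<M}" by auto
    then have "(\<Prod>c\<in>{..<Suc t} \<times> {..<M}. l c e) = L e * (\<Prod>c\<in>{t} \<times> {..<M}. l c e)"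
      unfolding L_def by (simp only:, intro prod.union_disjoint) auto
    then show "(F e * L e) * (\<Prod>c\<in>{t} \<times> {..<M}. l c e) = F e * (\<Prod>c\<in>{..<Suc t} \<times> {..<M}. l c e)"
      by (simp add: mult.assoc)
  qed
  finally show ?case unfolding l_def .
qed

section \<open>Pull counts and the effect of one additional good item\<close>

definition pulls ::
  "nat \<Rightarrow> nat \<Rightarrow> (nat \<Rightarrow> nat \<Rightarrow> real) \<Rightarrow> policy \<Rightarrow> (nat \<Rightarrow> real) \<Rightarrow> feedback \<Rightarrow> nat \<Rightarrow> real" where
  "pulls M T P \<rho> w e i = (\<Sum>(t, u)\<in>{..<T} \<times> {..<M}. of_bool (recommended M P \<rho> w e t u = i))"

lemma pulls_nonneg: "0 \<le> pulls M T P \<rho> w e i"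
  unfolding pulls_def by (intro sum_nonneg) auto

lemma pulls_le:
  assumes "blocked_policy M N T B W \<rho>" "w \<in> space W" "i < N"
  shows "pulls M T P \<rho> w e i \<le> real M * real B"
proof -
  have "pulls M T P \<rho> w e i = (\<Sum>u<M. \<Sum>t<T. of_bool (recommended M P \<rho> w e t u = i))"
    unfolding pulls_def by (subst sum.cartesian_product[symmetric], rule sum.swap)
  also have "\<dots> = (\<Sum>u<M. real (card {t\<in>{..<T}. recommended M P \<rho> w e t u = i}))"
    by (simp add: sum_of_bool_eq Int_def)
  also have "\<dots> \<le> (\<Sum>u<M. real B)"
    using card_recommended_le[OF assms(1,2) _ assms(3)] by (intro sum_mono) simp
  finally show ?thesis by simp
qed

lemma sum_pulls:
  assumes "blocked_policy M N T B W \<rho>" "w \<in> space W"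
  shows "(\<Sum>i<N. pulls M T P \<rho> w e i) = real M * real T"
proof -
  have "(\<Sum>i<N. pulls M T P \<rho> w e i)
      = (\<Sum>(t, u)\<in>{..<T} \<times> {..<M}. \<Sum>i<N. of_bool (recommended M P \<rho> w e t u = i))"
    unfolding pulls_def by (subst sum.swap) (simp add: case_prod_beta)
  also have "\<dots> = (\<Sum>(t, u)\<in>{..<T} \<times> {..<M}. 1)"
    using recommended_less[OF assms] by (intro sum.cong) (auto simp: of_bool_def)
  finally show ?thesis by (simp add: case_prod_beta)
qed

lemma measurable_pulls:
  assumes pol: "blocked_policy M N T B W \<rho>"
  shows "(\<lambda>(w, e). pulls M T P \<rho> w e i) \<in> borel_measurable (W \<Otimes>\<^sub>M gaussian_noise M T)"
proof -
  have "(\<lambda>(w, e). of_bool (recommended M P \<rho> w e t u = i) :: real)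
      \<in> borel_measurable (W \<Otimes>\<^sub>M gaussian_noise M T)" if "t < T" "u < M" for t u
  proof -
    have "(\<lambda>j. of_bool (j = i) :: real) \<in> borel_measurable (count_space UNIV)" by simp
    from measurable_compose[OF measurable_recommended[OF pol that] this]
    show ?thesis by (simp add: case_prod_beta')
  qed
  then show ?thesis
    unfolding pulls_def case_prod_beta' by (intro borel_measurable_sum) auto
qed

lemma measurable_pulls_seed:
  assumes "blocked_policy M N T B W \<rho>" "w \<in> space W"
  shows "(\<lambda>e. pulls M T P \<rho> w e i) \<in> borel_measurable (gaussian_noise M T)"
  using measurable_compose[OF measurable_Pair1' measurable_pulls[OF assms(1)]] assms(2)
  by simp

definition two_level :: "real \<Rightarrow> nat set \<Rightarrow> nat \<Rightarrow> nat \<Rightarrow> real" where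
  "two_level \<epsilon> S u i = (if i \<in> S then \<epsilon> else 0)"

text \<open>From \<open>2 * x \<le> exp x\<close> follows
  \<open>exp x \<le> 2 + 2 * (exp x - 1 - x)\<close>; the bracket is nonnegative, so its factor
  \<open>a\<close> can be raised to \<open>b\<close>. When \<open>x\<close> is a log-likelihood
  ratio, the expected bracket is a relative entropy.\<close>

lemma mult_exp_le:
  fixes a b x :: real
  assumes "0 \<le> a" "a \<le> b"
  shows "a * exp x \<le> 2 * a + 2 * b * (exp x - 1 - x)"
proof -
  have "2 * x \<le> exp x"
  proof -
    have "x \<le> exp (x - 1)" using exp_ge_add_one_self[of "x - 1"] by simp
    then have "x * exp 1 \<le> exp x" by (simp add: exp_diff pos_le_divide_eq)
    moreover have "2 * x \<le> x * exp 1" if "x \<ge> 0"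
      using exp_ge_add_one_self[of 1] that mult_left_mono[of 2 "exp 1" x] by simp
    moreover have "2 * x \<le> exp x" if "x < 0"
      using that exp_gt_zero[of x] by linarith
    ultimately show ?thesis by linarith
  qed
  then have "a * exp x \<le> a * (2 + 2 * (exp x - 1 - x))"
    using assms by (intro mult_left_mono) auto
  also have "\<dots> \<le> 2 * a + b * (2 * (exp x - 1 - x))"
    using mult_right_mono[OF assms(2), of "2 * (exp x - 1 - x)"] exp_ge_add_one_self[of x]
    by (simp add: algebra_simps)
  finally show ?thesis by (simp add: algebra_simps)
qed

text \<open>For a fixed seed the run is a function of the noise alone. The pull count of
  \<open>i\<close> for the enlarged set is the old count at shifted noise, hence an expectation
  weighted by the likelihood ratio. Only pulls of \<open>i\<close> contribute relative entropy,
  which makes the bound multiplicative.\<close>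

lemma nn_integral_pulls_insert_le:
  assumes pol: "blocked_policy M N T B W \<rho>" and w: "w \<in> space W" and i: "i < N" "i \<notin> R"
  shows "(\<integral>\<^sup>+e. ennreal (pulls M T (two_level \<epsilon> (insert i R)) \<rho> w e i) \<partial>gaussian_noise M T)
    \<le> ennreal (2 + \<epsilon>\<^sup>2 * real M * real B) *
       (\<integral>\<^sup>+e. ennreal (pulls M T (two_level \<epsilon> R) \<rho> w e i) \<partial>gaussian_noise M T)"
proof -
  define P Q where "P = two_level \<epsilon> (insert i R)" and "Q = two_level \<epsilon> R"
  let ?G = "gaussian_noise M T" and ?I = "{..<T} \<times> {..<M}"
  define n where "n e = pulls M T Q \<rho> w e i" for e
  define a where "a = reward_gap M P Q Q \<rho> w"
  define X where "X e = (\<Sum>c\<in>?I. a c e * e c - (a c e)\<^sup>2 / 2)" for e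
  interpret G: prob_space ?G
    unfolding gaussian_noise_def by (rule prob_space_PiM_std_normal)
  \<comment> \<open>The two instances differ only at item \<open>i\<close>, by \<epsilon>, so the
    gap marks exactly the cells in which \<open>i\<close> is pulled.\<close>
  have a_eq: "a (s, u) e = \<epsilon> * of_bool (recommended M Q \<rho> w e s u = i)" for s u e
    using i by (auto simp: a_def reward_gap_def P_def Q_def two_level_def)
  have a_abs: "\<bar>a c e\<bar> \<le> \<bar>\<epsilon>\<bar>" for c e
    by (cases c) (simp add: a_eq of_bool_def)
  have a_meas: "a c \<in> borel_measurable ?G" if "c \<in> ?I" for c
    unfolding a_def using measurable_reward_gap[OF pol w that] .
  have n_meas [measurable]: "n \<in> borel_measurable ?G"
    unfolding n_def[abs_def] by (rule measurable_pulls_seed[OF pol w])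
  have n_nonneg: "0 \<le> n e" and n_le: "n e \<le> real M * real B" for e
    unfolding n_def by (rule pulls_nonneg, rule pulls_le[OF pol w i(1)])
  have n_int: "integrable ?G n"
    by (rule G.integrable_const_bound[where B = "real M * real B"]) (auto simp: n_nonneg n_le)
  have a_int: "integrable ?G (\<lambda>e. a c e * e c)" "(\<integral>e. a c e * e c \<partial>?G) = 0"
    "integrable ?G (\<lambda>e. (a c e)\<^sup>2)" if c: "c \<in> ?I" for c
  proof -
    have "a c (e(c := y)) = a c e" for e y
      unfolding a_def by (rule reward_gap_cong) auto
    with c a_abs a_meas[OF c]
    show "integrable ?G (\<lambda>e. a c e * e c)" "(\<integral>e. a c e * e c \<partial>?G) = 0"
      unfolding gaussian_noise_def
      by (intro integrable_mult_std_normal_coordinate integral_mult_std_normal_coordinate; auto)+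
    note [measurable] = a_meas[OF c]
    show "integrable ?G (\<lambda>e. (a c e)\<^sup>2)"
      using a_abs by (intro G.integrable_const_bound[where B = "\<epsilon>\<^sup>2"]) (auto simp: abs_le_square_iff)
  qed
  have X_int: "integrable ?G X"
    unfolding X_def[abs_def] using a_int by (intro Bochner_Integration.integrable_sum) auto
  \<comment> \<open>The terms linear in the noise have mean zero; since each gap is \<epsilon> or 0,
    the squares add up to \<open>\<epsilon>\<^sup>2 * n e\<close>.\<close>
  have "(\<integral>e. X e \<partial>?G) = (\<Sum>c\<in>?I. (\<integral>e. a c e * e c \<partial>?G) - (\<integral>e. (a c e)\<^sup>2 / 2 \<partial>?G))"
    unfolding X_def using a_int
    by (subst Bochner_Integration.integral_sum; (intro sum.cong refl Bochner_Integration.integral_diff)?; auto)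
  also have "\<dots> = - (\<integral>e. (\<Sum>c\<in>?I. (a c e)\<^sup>2 / 2) \<partial>?G)"
    using a_int by (subst Bochner_Integration.integral_sum) (auto simp: sum_negf)
  also have "(\<lambda>e. \<Sum>c\<in>?I. (a c e)\<^sup>2 / 2) = (\<lambda>e. \<epsilon>\<^sup>2 / 2 * n e)"
    by (auto simp: fun_eq_iff n_def pulls_def sum_distrib_left a_eq power_mult_distrib
        case_prod_beta split_beta of_bool_def intro!: sum.cong)
  finally have X_integral: "(\<integral>e. X e \<partial>?G) = - (\<epsilon>\<^sup>2 / 2 * (\<integral>e. n e \<partial>?G))" by simp
  have girsanov: "(\<integral>\<^sup>+e. F (shift_noise M P Q \<rho> w T e) \<partial>?G) = (\<integral>\<^sup>+e. F e * ennreal (exp (X e)) \<partial>?G)"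
    if "F \<in> borel_measurable ?G" for F
  proof -
    have "(\<Prod>c\<in>?I. ennreal (exp (a c e * e c - (a c e)\<^sup>2 / 2))) = ennreal (exp (X e))" for e
      by (simp add: X_def exp_sum prod_ennreal)
    with nn_integral_shift_noise[OF pol w order_refl that, of P Q]
    show ?thesis by (simp add: a_def)
  qed
  \<comment> \<open>The constant integrand 1 shows that the likelihood ratio has total mass 1, which
    also makes \<open>exp X\<close> integrable.\<close>
  have exp_nn: "(\<integral>\<^sup>+e. ennreal (exp (X e)) \<partial>?G) = 1"
    using girsanov[of "\<lambda>_. 1"] by (simp add: G.emeasure_space_1)
  have exp_int: "integrable ?G (\<lambda>e. exp (X e))"
    using exp_nn X_int by (intro integrableI_nonneg) auto
  have exp_integral: "(\<integral>e. exp (X e) \<partial>?G) = 1"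
    using exp_nn exp_int by (simp add: nn_integral_eq_integral)
  have "(\<integral>\<^sup>+e. ennreal (pulls M T P \<rho> w e i) \<partial>?G) = (\<integral>\<^sup>+e. ennreal (n (shift_noise M P Q \<rho> w T e)) \<partial>?G)"
    unfolding n_def pulls_def
    by (intro nn_integral_cong arg_cong[where f = ennreal] sum.cong) (auto simp: recommended_shift_noise)
  also have "\<dots> = (\<integral>\<^sup>+e. ennreal (n e) * ennreal (exp (X e)) \<partial>?G)"
    by (rule girsanov[of "\<lambda>e. ennreal (n e)"]) measurable
  also have "\<dots> \<le> (\<integral>\<^sup>+e. ennreal (2 * n e + 2 * (real M * real B) * (exp (X e) - 1 - X e)) \<partial>?G)"
    using mult_exp_le[OF n_nonneg n_le] n_nonneg
    by (intro nn_integral_mono) (auto simp: ennreal_mult[symmetric] intro!: ennreal_leI)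
  also have "\<dots> = ennreal (\<integral>e. 2 * n e + 2 * (real M * real B) * (exp (X e) - 1 - X e) \<partial>?G)"
  proof (rule nn_integral_eq_integral)
    show "integrable ?G (\<lambda>e. 2 * n e + 2 * (real M * real B) * (exp (X e) - 1 - X e))"
      using n_int exp_int X_int by simp
    show "AE e in ?G. 0 \<le> 2 * n e + 2 * (real M * real B) * (exp (X e) - 1 - X e)"
      using mult_exp_le[OF n_nonneg n_le] n_nonneg
      by (intro AE_I2 order_trans[OF mult_nonneg_nonneg mult_exp_le]) (auto simp: n_le)
  qed
  \<comment> \<open>As \<open>exp X\<close> has mean 1, the bracket integrates to minus the mean of
    \<open>X\<close>; the factor 2 cancels the half in that mean.\<close>
  also have "(\<integral>e. 2 * n e + 2 * (real M * real B) * (exp (X e) - 1 - X e) \<partial>?G)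
      = (2 + \<epsilon>\<^sup>2 * real M * real B) * (\<integral>e. n e \<partial>?G)"
    using n_int exp_int X_int by (simp add: exp_integral X_integral G.prob_space algebra_simps)
  also have "ennreal \<dots> = ennreal (2 + \<epsilon>\<^sup>2 * real M * real B) * (\<integral>\<^sup>+e. ennreal (n e) \<partial>?G)"
    using n_int n_nonneg by (simp add: nn_integral_eq_integral ennreal_mult)
  finally show ?thesis unfolding P_def n_def Q_def .
qed

definition expected_pulls ::
  "nat \<Rightarrow> nat \<Rightarrow> (nat \<Rightarrow> real) measure \<Rightarrow> policy \<Rightarrow> (nat \<Rightarrow> nat \<Rightarrow> real) \<Rightarrow> nat \<Rightarrow> real" where
  "expected_pulls M T W \<rho> P i = (\<integral>(w, e). pulls M T P \<rho> w e i \<partial>(W \<Otimes>\<^sub>M gaussian_noise M T))"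

lemma prob_space_run:
  assumes "blocked_policy M N T B W \<rho>"
  shows "prob_space (W \<Otimes>\<^sub>M gaussian_noise M T)"
proof -
  interpret W: prob_space W using assms by (simp add: blocked_policy_def)
  interpret G: prob_space "gaussian_noise M T"
    unfolding gaussian_noise_def by (rule prob_space_PiM_std_normal)
  interpret pair_prob_space W "gaussian_noise M T" ..
  show ?thesis by (rule prob_space_axioms)
qed

lemma integrable_pulls:
  assumes pol: "blocked_policy M N T B W \<rho>" and "i < N"
  shows "integrable (W \<Otimes>\<^sub>M gaussian_noise M T) (\<lambda>(w, e). pulls M T P \<rho> w e i)"
proof -
  interpret prob_space "W \<Otimes>\<^sub>M gaussian_noise M T" using pol by (rule prob_space_run)
  show ?thesis
    using measurable_pulls[OF pol] pulls_le[OF pol] \<open>i < N\<close>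
    by (intro integrable_const_bound[where B = "real M * real B"])
       (auto simp: pulls_nonneg space_pair_measure)
qed

lemma expected_pulls_nonneg: "0 \<le> expected_pulls M T W \<rho> P i"
  unfolding expected_pulls_def by (intro Bochner_Integration.integral_nonneg) (auto simp: pulls_nonneg)

lemma sum_expected_pulls:
  assumes pol: "blocked_policy M N T B W \<rho>"
  shows "(\<Sum>i<N. expected_pulls M T W \<rho> P i) = real M * real T"
proof -
  let ?\<Omega> = "W \<Otimes>\<^sub>M gaussian_noise M T"
  interpret prob_space ?\<Omega> using pol by (rule prob_space_run)
  have "(\<Sum>i<N. expected_pulls M T W \<rho> P i) = (\<integral>x. (\<Sum>i<N. pulls M T P \<rho> (fst x) (snd x) i) \<partial>?\<Omega>)"
    using integrable_pulls[OF pol]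
    by (subst Bochner_Integration.integral_sum) (auto simp: expected_pulls_def case_prod_beta')
  also have "\<dots> = (\<integral>x. real M * real T \<partial>?\<Omega>)"
    using sum_pulls[OF pol] by (intro Bochner_Integration.integral_cong) (auto simp: space_pair_measure)
  finally show ?thesis by (simp add: prob_space)
qed

text \<open>The bound for fixed seeds is averaged over \<open>W\<close> by Tonelli; its factor is
  the same for every seed.\<close>

lemma expected_pulls_insert_le:
  assumes pol: "blocked_policy M N T B W \<rho>" and i: "i < N" "i \<notin> R"
  shows "expected_pulls M T W \<rho> (two_level \<epsilon> (insert i R)) i
    \<le> (2 + \<epsilon>\<^sup>2 * real M * real B) * expected_pulls M T W \<rho> (two_level \<epsilon> R) i"
proof -
  let ?G = "gaussian_noise M T"
  interpret G: prob_space ?G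
    unfolding gaussian_noise_def by (rule prob_space_PiM_std_normal)
  have nn: "ennreal (expected_pulls M T W \<rho> P i) = (\<integral>\<^sup>+w. \<integral>\<^sup>+e. ennreal (pulls M T P \<rho> w e i) \<partial>?G \<partial>W)" for P
  proof -
    have "ennreal (expected_pulls M T W \<rho> P i)
        = (\<integral>\<^sup>+x. ennreal (case x of (w, e) \<Rightarrow> pulls M T P \<rho> w e i) \<partial>(W \<Otimes>\<^sub>M ?G))"
      unfolding expected_pulls_def using integrable_pulls[OF pol i(1)]
      by (intro nn_integral_eq_integral[symmetric]) (auto simp: pulls_nonneg)
    also have "\<dots> = (\<integral>\<^sup>+w. \<integral>\<^sup>+e. ennreal (pulls M T P \<rho> w e i) \<partial>?G \<partial>W)"
      using measurable_pulls[OF pol] by (subst G.nn_integral_fst[symmetric]) auto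
    finally show ?thesis .
  qed
  have meas: "(\<lambda>w. \<integral>\<^sup>+e. ennreal (pulls M T P \<rho> w e i) \<partial>?G) \<in> borel_measurable W" for P
    using measurable_pulls[OF pol, of P i]
    by (intro G.borel_measurable_nn_integral) (simp add: case_prod_beta')
  have "ennreal (expected_pulls M T W \<rho> (two_level \<epsilon> (insert i R)) i)
      \<le> (\<integral>\<^sup>+w. ennreal (2 + \<epsilon>\<^sup>2 * real M * real B) *
          (\<integral>\<^sup>+e. ennreal (pulls M T (two_level \<epsilon> R) \<rho> w e i) \<partial>?G) \<partial>W)"
    unfolding nn using nn_integral_pulls_insert_le[OF pol _ i] by (intro nn_integral_mono)
  also have "\<dots> = ennreal ((2 + \<epsilon>\<^sup>2 * real M * real B) * expected_pulls M T W \<rho> (two_level \<epsilon> R) i)"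
    using meas by (simp add: nn_integral_cmult nn ennreal_mult expected_pulls_nonneg)
  finally show ?thesis
    by (simp add: expected_pulls_nonneg)
qed


section \<open>Regret on two-level instances, and averaging over the sets of good items\<close>

lemma two_level_item_ranking:
  assumes "0 < \<epsilon>" "S \<subseteq> {..<N}" "s < card S"
  shows "two_level \<epsilon> S u (item_ranking N (two_level \<epsilon> S u) s) = \<epsilon>"
proof (rule ccontr)
  define \<pi> where "\<pi> = item_ranking N (two_level \<epsilon> S u)"
  assume "two_level \<epsilon> S u (item_ranking N (two_level \<epsilon> S u) s) \<noteq> \<epsilon>"
  then have s: "\<pi> s \<notin> S" by (auto simp: \<pi>_def two_level_def)
  have \<pi>: "\<pi> permutes {..<N}"
    and sorted: "\<And>i j. i < j \<Longrightarrow> j < N \<Longrightarrow> two_level \<epsilon> S u (\<pi> j) \<le> two_level \<epsilon> S u (\<pi> i)"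
    using ranks_items_item_ranking[of N "two_level \<epsilon> S u"] by (auto simp: ranks_items_def \<pi>_def)
  \<comment> \<open>With position \<open>s\<close> outside \<open>S\<close>, monotonicity forces all
    of \<open>S\<close> into the \<open>s\<close> positions before it, too few for
    \<open>s < card S\<close>.\<close>
  have "S \<subseteq> \<pi> ` {..<s}"
  proof
    fix i assume "i \<in> S"
    then have "i \<in> \<pi> ` {..<N}" using assms(2) permutes_image[OF \<pi>] by auto
    then obtain j where j: "i = \<pi> j" "j < N" by auto
    have "j \<noteq> s" using s \<open>i \<in> S\<close> j by auto
    moreover have "\<not> s < j"
      using sorted[of s j] j s \<open>i \<in> S\<close> assms(1) by (auto simp: two_level_def)
    ultimately show "i \<in> \<pi> ` {..<s}" using j by auto
  qed
  then have "card S \<le> card (\<pi> ` {..<s})" by (intro card_mono) auto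
  also have "\<dots> \<le> s" using card_image_le[of "{..<s}" \<pi>] by simp
  finally show False using assms(3) by simp
qed

text \<open>The \<open>T div B\<close> good items fill the top \<open>T div B\<close> ranks, each
  usable \<open>B\<close> times, and \<open>B dvd T\<close> makes this exactly \<open>T\<close>
  rounds. Hence the benchmark \<open>\<epsilon> * T\<close>.\<close>

lemma regret_two_level:
  assumes pol: "blocked_policy M N T B W \<rho>" and "0 < \<epsilon>" "M > 0" "B dvd T"
    and S: "S \<subseteq> {..<N}" "card S = T div B"
  shows "regret M N T B W \<rho> (two_level \<epsilon> S)
    = \<epsilon> * real T - \<epsilon> / real M * (\<Sum>i\<in>S. expected_pulls M T W \<rho> (two_level \<epsilon> S) i)"
proof -
  let ?P = "two_level \<epsilon> S" and ?\<Omega> = "W \<Otimes>\<^sub>M gaussian_noise M T"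
  have fin: "finite S" using S finite_subset by blast
  have "(\<Sum>s<T div B. \<Sum>u<M. real B * ?P u (item_ranking N (?P u) s) / real M)
      = (\<Sum>s<T div B. \<Sum>u<M. real B * \<epsilon> / real M)"
    using two_level_item_ranking[OF \<open>0 < \<epsilon>\<close> S(1)] S(2) by (intro sum.cong) auto
  also have "\<dots> = \<epsilon> * real (T div B * B)" using \<open>M > 0\<close> by simp
  also have "T div B * B = T" using \<open>B dvd T\<close> by simp
  finally have best: "(\<Sum>s<T div B. \<Sum>u<M. real B * ?P u (item_ranking N (?P u) s) / real M) = \<epsilon> * real T" .
  have "(\<Sum>t<T. \<Sum>u<M. ?P u (recommended M ?P \<rho> w e t u) / real M)
      = \<epsilon> / real M * (\<Sum>i\<in>S. pulls M T ?P \<rho> w e i)" for w e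
  proof -
    have "?P u j / real M = \<epsilon> / real M * (\<Sum>i\<in>S. of_bool (j = i))" for u j
      using fin by (simp add: two_level_def of_bool_def)
    then have "(\<Sum>t<T. \<Sum>u<M. ?P u (recommended M ?P \<rho> w e t u) / real M)
        = \<epsilon> / real M * (\<Sum>(t, u)\<in>{..<T} \<times> {..<M}. \<Sum>i\<in>S. of_bool (recommended M ?P \<rho> w e t u = i))"
      by (subst sum.cartesian_product) (simp only: sum_distrib_left case_prod_beta')
    also have "(\<Sum>(t, u)\<in>{..<T} \<times> {..<M}. \<Sum>i\<in>S. of_bool (recommended M ?P \<rho> w e t u = i))
        = (\<Sum>i\<in>S. pulls M T ?P \<rho> w e i)"
      unfolding pulls_def case_prod_beta by (rule sum.swap)
    finally show ?thesis .
  qed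
  then have "(\<integral>(w, e). (\<Sum>t<T. \<Sum>u<M. ?P u (recommended M ?P \<rho> w e t u) / real M) \<partial>?\<Omega>)
      = \<epsilon> / real M * (\<integral>x. (\<Sum>i\<in>S. pulls M T ?P \<rho> (fst x) (snd x) i) \<partial>?\<Omega>)"
    by (simp add: case_prod_beta')
  also have "(\<integral>x. (\<Sum>i\<in>S. pulls M T ?P \<rho> (fst x) (snd x) i) \<partial>?\<Omega>)
      = (\<Sum>i\<in>S. expected_pulls M T W \<rho> ?P i)"
    using integrable_pulls[OF pol] S(1)
    by (subst Bochner_Integration.integral_sum) (auto simp: expected_pulls_def case_prod_beta')
  finally show ?thesis by (simp add: regret_def best)
qed

text \<open>Double counting: a set with a marked element corresponds to the set without it together
  with an outside element.\<close>

lemma sum_subsets_Suc: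
  fixes g :: "'a set \<Rightarrow> 'a \<Rightarrow> real"
  assumes "finite A"
  shows "(\<Sum>S | S \<subseteq> A \<and> card S = Suc k. \<Sum>i\<in>S. g S i)
    = (\<Sum>R | R \<subseteq> A \<and> card R = k. \<Sum>i\<in>A - R. g (insert i R) i)"
proof -
  have fin: "finite {S. S \<subseteq> A \<and> card S = n}" for n using assms by simp
  have fin': "finite S" if "S \<subseteq> A" for S using that assms finite_subset by blast
  have "(\<Sum>S | S \<subseteq> A \<and> card S = Suc k. \<Sum>i\<in>S. g S i)
      = (\<Sum>(S, i)\<in>(SIGMA S:{S. S \<subseteq> A \<and> card S = Suc k}. S). g S i)"
    using fin fin' by (subst sum.Sigma) auto
  also have "\<dots> = (\<Sum>(R, i)\<in>(SIGMA R:{R. R \<subseteq> A \<and> card R = k}. A - R). g (insert i R) i)"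
    by (rule sum.reindex_bij_witness[where i = "\<lambda>(R, i). (insert i R, i)" and j = "\<lambda>(S, i). (S - {i}, i)"])
       (auto simp: insert_absorb fin' card_insert_if)
  also have "\<dots> = (\<Sum>R | R \<subseteq> A \<and> card R = k. \<Sum>i\<in>A - R. g (insert i R) i)"
    using fin assms by (subst sum.Sigma) auto
  finally show ?thesis .
qed

lemma exists_set_few_pulls:
  assumes pol: "blocked_policy M N T B W \<rho>" and T: "T > 0" "B > 0" "B dvd T" and "M > 0"
    and N: "16 * T \<le> N" and \<epsilon>: "8 * \<epsilon>\<^sup>2 * real M * real T \<le> real N"
  obtains S where "S \<subseteq> {..<N}" "card S = T div B"
    "(\<Sum>i\<in>S. expected_pulls M T W \<rho> (two_level \<epsilon> S) i) \<le> real M * real T / 2"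
proof -
  obtain k where k: "T div B = Suc k"
    using T by (metis dvd_div_eq_0_iff not0_implies_Suc not_gr_zero)
  define \<S> where "\<S> n = {S. S \<subseteq> {..<N} \<and> card S = n}" for n
  have card_\<S>: "card (\<S> n) = N choose n" for n
    unfolding \<S>_def using n_subsets[of "{..<N}" n] by simp
  have fin: "finite (\<S> n)" for n by (simp add: \<S>_def)
  define D where "D = 2 + \<epsilon>\<^sup>2 * real M * real B"
  have "D \<ge> 0" by (simp add: D_def)
  have kT: "Suc k \<le> T" using k div_le_dividend[of T B] by simp
  have kB: "real (Suc k) * real B = real T"
    using T k by (metis dvd_div_mult_self of_nat_mult)
  have "\<exists>S\<in>\<S> (Suc k). (\<Sum>i\<in>S. expected_pulls M T W \<rho> (two_level \<epsilon> S) i) \<le> real M * real T / 2"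
  proof (rule ccontr)
    \<comment> \<open>If every good set received more than half of the pulls, summing over all of
      them would contradict the upper bound derived next.\<close>
    assume "\<not> ?thesis"
    then have "real (N choose Suc k) * (real M * real T / 2)
        \<le> (\<Sum>S\<in>\<S> (Suc k). \<Sum>i\<in>S. expected_pulls M T W \<rho> (two_level \<epsilon> S) i)"
      unfolding card_\<S>[symmetric] by (intro sum_bounded_below) (auto simp: not_le less_imp_le)
    also have "\<dots> = (\<Sum>R\<in>\<S> k. \<Sum>i\<in>{..<N} - R. expected_pulls M T W \<rho> (two_level \<epsilon> (insert i R)) i)"
      unfolding \<S>_def by (rule sum_subsets_Suc) simp
    \<comment> \<open>For fixed \<open>R\<close>, the items outside \<open>R\<close> together
      receive at most all \<open>M * T\<close> pulls of the instance \<open>R\<close>, however many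
      they are; each count grows at most by the factor \<open>D\<close>.\<close>
    also have "\<dots> \<le> (\<Sum>R\<in>\<S> k. D * (real M * real T))"
    proof (rule sum_mono)
      fix R
      have "(\<Sum>i\<in>{..<N} - R. expected_pulls M T W \<rho> (two_level \<epsilon> (insert i R)) i)
          \<le> (\<Sum>i\<in>{..<N} - R. D * expected_pulls M T W \<rho> (two_level \<epsilon> R) i)"
        using expected_pulls_insert_le[OF pol] by (intro sum_mono) (auto simp: D_def)
      also have "\<dots> \<le> (\<Sum>i<N. D * expected_pulls M T W \<rho> (two_level \<epsilon> R) i)"
        using \<open>D \<ge> 0\<close> by (intro sum_mono2) (auto simp: expected_pulls_nonneg)
      also have "\<dots> = D * (real M * real T)"
        by (simp add: sum_expected_pulls[OF pol] sum_distrib_left[symmetric])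
      finally show "(\<Sum>i\<in>{..<N} - R. expected_pulls M T W \<rho> (two_level \<epsilon> (insert i R)) i)
          \<le> D * (real M * real T)" .
    qed
    also have "\<dots> = real (N choose k) * D * (real M * real T)"
      by (simp add: card_\<S>)
    finally have "(real (N choose Suc k) / 2) * (real M * real T) \<le> (real (N choose k) * D) * (real M * real T)"
      by simp
    then have le: "real (N choose Suc k) \<le> 2 * D * real (N choose k)"
      using T \<open>M > 0\<close> by (subst (asm) mult_le_cancel_right_pos) (auto simp: mult_ac)
    \<comment> \<open>Consecutive binomial coefficients have ratio \<open>(N - k) / (k + 1)\<close>,
      so the averaged inequality bounds \<open>N - k\<close>.\<close>
    have "Suc k * (N choose Suc k) = (N - k) * (N choose k)"
      using binomial_absorption[of k N] binomial_absorb_comp[of N k] by simp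
    then have "real (N - k) * real (N choose k) = real (Suc k) * real (N choose Suc k)"
      by (simp only: of_nat_mult[symmetric])
    also have "\<dots> \<le> real (Suc k) * (2 * D * real (N choose k))"
      using le by (intro mult_left_mono) auto
    finally have "real (N - k) \<le> real (Suc k) * (2 * D)"
      using kT N by (simp add: mult.assoc[symmetric] del: of_nat_Suc)
    also have "\<dots> = 4 * real (Suc k) + 2 * \<epsilon>\<^sup>2 * real M * (real (Suc k) * real B)"
      by (simp add: D_def algebra_simps)
    \<comment> \<open>The first quarter comes from \<open>k + 1 \<le> T\<close> and
      \<open>16 * T \<le> N\<close>, the second from the bound on \<epsilon>. As
      \<open>k < T\<close>, \<open>N - k\<close> exceeds \<open>N / 2\<close>, a
      contradiction.\<close>
    also have "\<dots> \<le> real N / 4 + real N / 4"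
      using kT N \<epsilon> unfolding kB by (intro add_mono) auto
    finally show False using kT N T(1) by (simp add: of_nat_diff)
  qed
  then show thesis using that k by (auto simp: \<S>_def)
qed

section \<open>Comparison with the claimed rate, and choice of \<epsilon>\<close>

lemma rate_le_sqrt:
  fixes M N T B :: real
  assumes "0 < T" "T \<le> N" "1 \<le> B" "B \<le> T" "0 < M"
  shows "max (sqrt (N * B / M)) (T * sqrt (ln (N / T)) / (B * sqrt M)) \<le> sqrt (N * T / M)"
proof (rule max.boundedI)
  show "sqrt (N * B / M) \<le> sqrt (N * T / M)"
    using assms by (intro real_sqrt_le_mono divide_right_mono mult_left_mono) auto
  \<comment> \<open>Bounding the logarithm by its argument and \<open>B\<close> below by 1 turns the
    second term into exactly the target.\<close>
  have "ln (N / T) \<le> N / T" using assms ln_le_minus_one[of "N / T"] by simp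
  then have "T * sqrt (ln (N / T)) / (B * sqrt M) \<le> T * sqrt (N / T) / (1 * sqrt M)"
    using assms by (intro frac_le mult_left_mono mult_right_mono real_sqrt_le_mono) auto
  also have "\<dots> = sqrt (T\<^sup>2 * (N / T) / M)"
    using assms by (simp add: real_sqrt_mult real_sqrt_divide)
  also have "T\<^sup>2 * (N / T) / M = N * T / M"
    using assms by (simp add: power2_eq_square)
  finally show "T * sqrt (ln (N / T)) / (B * sqrt M) \<le> sqrt (N * T / M)" .
qed

theorem theorem2:
  "\<exists>c>0. \<exists>K>0. \<forall>M N T B :: nat.
     T > 0 \<longrightarrow> B > 0 \<longrightarrow> B dvd T \<longrightarrow> T div B \<le> N \<longrightarrow>
     real M \<ge> K * real T \<longrightarrow> real N \<ge> K * real T \<longrightarrow>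
     (\<forall>W \<rho>. blocked_policy M N T B W \<rho> \<longrightarrow>
        (SUP P \<in> one_cluster_rewards M N. regret M N T B W \<rho> P) \<ge>
        c * min (real T)
              (max (sqrt (real N * real B / real M))
                   (real T * sqrt (ln (real N / real T)) / (real B * sqrt (real M)))))"
\<comment> \<open>The factor 16 is what \<open>exists_set_few_pulls\<close> asks of
  \<open>N\<close>. The constant 1/8 lies below both 1/2 and 1/6, the factors obtained in the two
  cases for \<epsilon> below.\<close>
proof (rule exI[of _ "1/8"], rule conjI, simp, rule exI[of _ 16], rule conjI, simp, intro allI impI)
  fix M N T B :: nat and W \<rho>
  assume T: "T > 0" and B: "B > 0" "B dvd T" and k: "T div B \<le> N"
    and M: "16 * real T \<le> real M" and N: "16 * real T \<le> real N"
    and pol: "blocked_policy M N T B W \<rho>"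
  have "M > 0" "N > 0" using M N T by auto
  define rate where "rate = max (sqrt (real N * real B / real M))
    (real T * sqrt (ln (real N / real T)) / (real B * sqrt (real M)))"
  \<comment> \<open>The largest value allowed by \<open>exists_set_few_pulls\<close>, capped at 1 to
    keep rewards in the unit interval.\<close>
  define \<epsilon> where "\<epsilon> = min 1 (sqrt (real N / (8 * real M * real T)))"
  have \<epsilon>: "0 < \<epsilon>" "\<epsilon> \<le> 1" using T \<open>M > 0\<close> \<open>N > 0\<close> by (auto simp: \<epsilon>_def)
  have "\<epsilon>\<^sup>2 \<le> (sqrt (real N / (8 * real M * real T)))\<^sup>2"
    using \<epsilon>(1) by (intro power_mono) (auto simp: \<epsilon>_def)
  then have "8 * \<epsilon>\<^sup>2 * real M * real T \<le> real N"
    using T \<open>M > 0\<close> by (simp add: field_simps)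
  then obtain S where S: "S \<subseteq> {..<N}" "card S = T div B"
      "(\<Sum>i\<in>S. expected_pulls M T W \<rho> (two_level \<epsilon> S) i) \<le> real M * real T / 2"
    using exists_set_few_pulls[OF pol T B \<open>M > 0\<close>] N by (metis of_nat_le_iff of_nat_mult of_nat_numeral)
  have "rate \<le> sqrt (real N * real T / real M)"
    unfolding rate_def using T B M N dvd_imp_le[OF B(2) T] by (intro rate_le_sqrt) auto
  \<comment> \<open>Squaring turns 3 into 9, which exceeds the 8 under the root.\<close>
  also have "\<dots> / (3 * real T) \<le> sqrt (real N / (8 * real M * real T))"
  proof (rule real_le_rsqrt)
    have "(sqrt (real N * real T / real M) / (3 * real T))\<^sup>2 = real N / (9 * real M * real T)"
      using T by (simp add: power_divide power_mult_distrib) (simp add: power2_eq_square)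
    also have "\<dots> \<le> real N / (8 * real M * real T)"
      using T \<open>M > 0\<close> by (intro divide_left_mono) auto
    finally show "(sqrt (real N * real T / real M) / (3 * real T))\<^sup>2 \<le> real N / (8 * real M * real T)" .
  qed
  finally have rate: "rate / (3 * real T) \<le> sqrt (real N / (8 * real M * real T))"
    using T by (simp add: divide_right_mono)
  \<comment> \<open>If the cap is active, half of \<open>T\<close> remains; otherwise
    \<open>rate \<le> 3 * \<epsilon> * T\<close> leaves a sixth of the rate.\<close>
  have "1 / 8 * min (real T) rate \<le> \<epsilon> * real T / 2"
  proof (cases "\<epsilon> = 1")
    case True
    then show ?thesis using T by (simp add: min_def)
  next
    case False
    then have "rate / (3 * real T) \<le> \<epsilon>" using rate by (auto simp: \<epsilon>_def min_def)
    then have "rate \<le> \<epsilon> * real T * 3" using T by (simp add: pos_divide_le_eq mult_ac)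
    moreover have "0 < \<epsilon> * real T" using \<epsilon>(1) T by simp
    ultimately show ?thesis using min.cobounded2[of "real T" rate] by linarith
  qed
  also have "\<dots> = \<epsilon> * real T - \<epsilon> / real M * (real M * real T / 2)"
    using \<open>M > 0\<close> by simp
  also have "\<dots> \<le> \<epsilon> * real T
      - \<epsilon> / real M * (\<Sum>i\<in>S. expected_pulls M T W \<rho> (two_level \<epsilon> S) i)"
    using S(3) \<epsilon>(1) by (intro diff_left_mono mult_left_mono) auto
  also have "\<dots> = regret M N T B W \<rho> (two_level \<epsilon> S)"
    using regret_two_level[OF pol \<epsilon>(1) \<open>M > 0\<close> B(2) S(1,2)] by simp
  \<comment> \<open>A real supremum dominates its members only when the family is bounded above,
    which \<open>regret_le_horizon\<close> provides.\<close>
  also have "\<dots> \<le> (SUP P \<in> one_cluster_rewards M N. regret M N T B W \<rho> P)"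
  proof (rule cSUP_upper)
    show "two_level \<epsilon> S \<in> one_cluster_rewards M N"
      using \<epsilon> by (auto simp: one_cluster_rewards_def two_level_def)
    show "bdd_above (regret M N T B W \<rho> ` one_cluster_rewards M N)"
      using regret_le_horizon[OF pol _ \<open>M > 0\<close> k] by (auto intro!: bdd_aboveI)
  qed
  finally show "1 / 8 * min (real T)
      (max (sqrt (real N * real B / real M))
        (real T * sqrt (ln (real N / real T)) / (real B * sqrt (real M))))
      \<le> (SUP P \<in> one_cluster_rewards M N. regret M N T B W \<rho> P)"
    unfolding rate_def .
qed

end
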